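(* Let $d\geq 2$ and let $S=(V,\mathcal{H})$ be a paving simplicial complex of dimension $d$. Then the following are equivalent: (i) $S$ is boolean representable; (ii) $\mathcal{H}=\bigcup\{\mathcal{B}_d(V,L) : L\in L(S)\setminus(P_{\leq d-1}(V)\cup\{V\})\}$; (iii) there exists a nonempty family $\mathcal{L}\subseteq P_{\geq d}(V)\setminus\{V\}$ with $|L\cap L'|\leq d-1$ for all distinct $L,L'\in\mathcal{L}$, such that $\mathcal{H}=\bigcup_{L\in\mathcal{L}}\mathcal{B}_d(V,L)$. Here $\mathcal{B}_d(V,L)=P_{\leq d}(V)\cup\{X\in P_{d+1}(V) : |X\cap L|=d\}$.
   Context: A (finite) simplicial complex is a pair $S=(V,\mathcal{H})$ where $V$ is a finite nonempty set and $\mathcal{H}\subseteq 2^V$ contains all singletons and is closed under taking subsets. Its dimension is $\max\{|I|:I\in\mathcal{H}\}-1$. $P_n(V)$ (resp. $P_{\leq n}(V)$, $P_{\geq n}(V)$) is the set of subsets of $V$ of size exactly (resp. at most, at least) $n$. $S$ is paving if $P_{\dim S}(V)\subseteq\mathcal{H}$. A flat of $S$ is $X\subseteq V$ with $I\cup\{p\}\in\mathcal{H}$ for all $I\in\mathcal{H}\cap 2^X$, $p\in V\setminus X$; $L(S)$ is the set of flats. $S$ is boolean representable if there is a boolean matrix $M$ with columns indexed by $V$ such that $\mathcal{H}$ is exactly the set of $X\subseteq V$ for which some square submatrix with column set $X$ is congruent (by permuting rows and columns) to a lower unitriangular boolean matrix; equivalently, $\mathcal{H}$ is the set of $X$ admitting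 an enumeration $x_1,\dots,x_k$ and a chain of flats $F_0\subset\cdots\subset F_k$ with $x_i\in F_i\setminus F_{i-1}$. *)

theory Defs
  imports Main "HOL-Library.Ramsey"
begin

text \<open>\<open>P\<^sub>n(V)\<close> is the library's \<open>nsets V n\<close>, the set of finite subsets of \<open>V\<close> with exactly
  \<open>n\<close> elements.\<close>

definition nsets_le :: "'a set \<Rightarrow> nat \<Rightarrow> 'a set set" where
  "nsets_le V n = {X. X \<subseteq> V \<and> finite X \<and> card X \<le> n}"

definition nsets_ge :: "'a set \<Rightarrow> nat \<Rightarrow> 'a set set" where
  "nsets_ge V n = {X. X \<subseteq> V \<and> finite X \<and> card X \<ge> n}"

definition simplicial_complex :: "'a set \<Rightarrow> 'a set set \<Rightarrow> bool" where
  "simplicial_complex V H \<longleftrightarrow>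
     finite V \<and> V \<noteq> {} \<and> H \<subseteq> Pow V \<and> (\<forall>v\<in>V. {v} \<in> H) \<and>
     (\<forall>I\<in>H. \<forall>J. J \<subseteq> I \<longrightarrow> J \<in> H)"

text \<open>In a simplicial complex the maximum is at least \<open>1\<close>, since the vertex set is nonempty and
  all singletons are faces; hence the subtraction does not truncate.\<close>

definition complex_dim :: "'a set set \<Rightarrow> nat" where
  "complex_dim H = Max (card ` H) - 1"

definition paving :: "'a set \<Rightarrow> 'a set set \<Rightarrow> bool" where
  "paving V H \<longleftrightarrow> nsets V (complex_dim H) \<subseteq> H"

definition flat :: "'a set \<Rightarrow> 'a set set \<Rightarrow> 'a set \<Rightarrow> bool" where
  "flat V H X \<longleftrightarrow> X \<subseteq> V \<and> (\<forall>I\<in>H \<inter> Pow X. \<forall>p\<in>V - X. insert p I \<in> H)"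

definition flats :: "'a set \<Rightarrow> 'a set set \<Rightarrow> 'a set set" where
  "flats V H = {X. flat V H X}"

text \<open>A boolean matrix is a function \<open>M\<close> with finitely many rows \<open>0, \<dots>, m - 1\<close> and columns indexed
  by \<open>V\<close>; \<open>True\<close> is the entry 1. The submatrix with row set \<open>R\<close> and column set \<open>X\<close> is square when
  \<open>R\<close> and \<open>X\<close> have the same size \<open>k\<close>; permuting its rows and columns amounts to listing \<open>R\<close> and \<open>X\<close>
  bijectively as \<open>r 0, \<dots>, r (k - 1)\<close> and \<open>c 0, \<dots>, c (k - 1)\<close>. Entries below the diagonal are
  unconstrained. The empty matrix (\<open>k = 0\<close>) counts as unitriangular.\<close>

definition congruent_lower_unitriangular ::
  "(nat \<Rightarrow> 'a \<Rightarrow> bool) \<Rightarrow> nat set \<Rightarrow> 'a set \<Rightarrow> bool" where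
  "congruent_lower_unitriangular M R X \<longleftrightarrow>
     (\<exists>(k::nat) r c. bij_betw r {..<k} R \<and> bij_betw c {..<k} X \<and>
        (\<forall>i<k. M (r i) (c i)) \<and>
        (\<forall>i<k. \<forall>j<k. i < j \<longrightarrow> \<not> M (r i) (c j)))"

definition boolean_representable :: "'a set \<Rightarrow> 'a set set \<Rightarrow> bool" where
  "boolean_representable V H \<longleftrightarrow>
     (\<exists>(m::nat) (M :: nat \<Rightarrow> 'a \<Rightarrow> bool).
        H = {X. X \<subseteq> V \<and> (\<exists>R \<subseteq> {..<m}. congruent_lower_unitriangular M R X)})"

definition B_complex :: "nat \<Rightarrow> 'a set \<Rightarrow> 'a set \<Rightarrow> 'a set set" where
  "B_complex d V L = nsets_le V d \<union> {X \<in> nsets V (d + 1). card (X \<inter> L) = d}"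

end

theory Submission
  imports Defs
begin

text \<open>A square boolean matrix with column set \<open>X\<close> is congruent to a lower unitriangular one iff
  one can peel off a row that has its only 1 (among the columns of \<open>X\<close>) in a column \<open>p\<close>, and continue
  with \<open>X - {p}\<close>. The zero set of a row of a representing matrix is a flat, and conversely the
  complements of the flats can serve as rows. Hence a complex is boolean representable iff every
  nonempty face \<open>X\<close> has a vertex \<open>p\<close> separated from \<open>X - {p}\<close> by a flat. In a paving complex of
  dimension \<open>d\<close> all sets of size less than \<open>d\<close> are flats, so this condition matters only for facets
  of size \<open>d + 1\<close>, where it says that some flat meets \<open>X\<close> in exactly \<open>d\<close> points.\<close>

section \<open>Prepending and peeling off rows of unitriangular matrices\<close>

lemma congruent_lower_unitriangular_empty: "congruent_lower_unitriangular M {} {}"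
  unfolding congruent_lower_unitriangular_def by (intro exI[of _ 0]) (auto simp: bij_betw_def)

lemma bij_betw_Suc_case_nat:
  assumes "bij_betw f {..<k} A" "x \<notin> A"
  shows "bij_betw (case_nat x f) {..<Suc k} (insert x A)"
  using assms unfolding bij_betw_def lessThan_Suc_eq_insert_0
  by (auto simp: inj_on_def image_image)

lemma bij_betw_Suc_tail:
  assumes "bij_betw f {..<Suc k} A"
  shows "bij_betw (\<lambda>i. f (Suc i)) {..<k} (A - {f 0})"
proof -
  have inj: "inj_on f {..<Suc k}" and A: "A = f ` {..<Suc k}"
    using assms by (auto simp: bij_betw_def)
  have "A - {f 0} = (\<lambda>i. f (Suc i)) ` {..<k}"
    using inj unfolding A lessThan_Suc_eq_insert_0
    by (auto simp: inj_on_def image_image)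
  moreover have "inj_on (\<lambda>i. f (Suc i)) {..<k}"
    using inj by (auto simp: inj_on_def)
  ultimately show ?thesis by (simp add: bij_betw_def)
qed

text \<open>Row \<open>q\<close> and column \<open>p\<close> are listed first. The only new zeros
  required are those of row \<open>q\<close> in the columns of \<open>X\<close>, since column
  \<open>p\<close> below its top entry is unconstrained.\<close>

lemma congruent_lower_unitriangular_insert:
  assumes "congruent_lower_unitriangular M R X"
    and q: "M q p" "\<And>x. x \<in> X \<Longrightarrow> \<not> M q x"
  shows "congruent_lower_unitriangular M (insert q R) (insert p X)"
proof -
  obtain k :: nat and r c where r: "bij_betw r {..<k} R" and c: "bij_betw c {..<k} X"
    and M: "\<forall>i<k. M (r i) (c i)" "\<forall>i<k. \<forall>j<k. i < j \<longrightarrow> \<not> M (r i) (c j)"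
    using assms(1) unfolding congruent_lower_unitriangular_def by blast
  have cX: "c i \<in> X" if "i < k" for i
    using c that by (auto simp: bij_betw_def)
  \<comment> \<open>Each row in \<open>R\<close> has its diagonal 1 in a column of \<open>X\<close>,
    whereas row \<open>q\<close> vanishes on \<open>X\<close>.\<close>
  have "q \<notin> R"
    using r M(1) cX q(2) by (auto simp: bij_betw_def)
  moreover have "p \<notin> X" using q by blast
  ultimately have "bij_betw (case_nat q r) {..<Suc k} (insert q R)"
    "bij_betw (case_nat p c) {..<Suc k} (insert p X)"
    using r c by (auto intro: bij_betw_Suc_case_nat)
  moreover have "\<forall>i<Suc k. M (case_nat q r i) (case_nat p c i)"
    using M(1) q(1) by (auto split: nat.split)
  moreover have "\<forall>i<Suc k. \<forall>j<Suc k. i < j \<longrightarrow> \<not> M (case_nat q r i) (case_nat p c j)"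
    using M(2) q(2) cX by (auto split: nat.split)
  ultimately show ?thesis
    unfolding congruent_lower_unitriangular_def by blast
qed

text \<open>The first row and column of the listing can be taken as \<open>q\<close> and
  \<open>p\<close>: everything to the right of the first diagonal entry is zero. This drives
  inductions on \<open>X\<close>.\<close>

lemma congruent_lower_unitriangular_remove:
  assumes "congruent_lower_unitriangular M R X" "X \<noteq> {}"
  obtains q p where "q \<in> R" "p \<in> X" "M q p" "\<And>x. x \<in> X - {p} \<Longrightarrow> \<not> M q x"
    "congruent_lower_unitriangular M (R - {q}) (X - {p})"
proof -
  obtain k :: nat and r c where r: "bij_betw r {..<k} R" and c: "bij_betw c {..<k} X"
    and M: "\<forall>i<k. M (r i) (c i)" "\<forall>i<k. \<forall>j<k. i < j \<longrightarrow> \<not> M (r i) (c j)"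
    using assms(1) unfolding congruent_lower_unitriangular_def by blast
  obtain l where k: "k = Suc l"
    using c assms(2) by (cases k) (auto simp: bij_betw_def)
  have tails: "bij_betw (\<lambda>i. r (Suc i)) {..<l} (R - {r 0})"
    "bij_betw (\<lambda>i. c (Suc i)) {..<l} (X - {c 0})"
    using r c unfolding k by (auto intro: bij_betw_Suc_tail)
  show thesis
  proof (rule that)
    show "r 0 \<in> R" "c 0 \<in> X" using r c k by (auto simp: bij_betw_def)
    show "M (r 0) (c 0)" using M(1) k by simp
    show "\<not> M (r 0) x" if "x \<in> X - {c 0}" for x
    proof -
      have "x \<in> (\<lambda>i. c (Suc i)) ` {..<l}" using tails(2) that by (simp add: bij_betw_def)
      then show ?thesis using M(2) k by auto
    qed
    show "congruent_lower_unitriangular M (R - {r 0}) (X - {c 0})"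
      unfolding congruent_lower_unitriangular_def
      using tails M k
      by (intro exI[of _ l] exI[of _ "\<lambda>i. r (Suc i)"] exI[of _ "\<lambda>i. c (Suc i)"]) auto
  qed
qed

lemma congruent_lower_unitriangular_finite:
  "congruent_lower_unitriangular M R X \<Longrightarrow> finite X"
  unfolding congruent_lower_unitriangular_def by (auto dest: bij_betw_finite)

section \<open>Boolean representability in terms of flats\<close>

text \<open>If \<open>I\<close> lies in the zero set of row \<open>q\<close> and \<open>p\<close>
  does not, then row \<open>q\<close> and column \<open>p\<close> can be prepended to a
  unitriangular submatrix witnessing \<open>I\<close>.\<close>

lemma flat_row_zero_set:
  assumes H: "H = {X. X \<subseteq> V \<and> (\<exists>R \<subseteq> {..<m}. congruent_lower_unitriangular M R X)}"
    and "q < m"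
  shows "flat V H {v \<in> V. \<not> M q v}"
  unfolding flat_def
proof (intro conjI ballI)
  fix I p assume I: "I \<in> H \<inter> Pow {v \<in> V. \<not> M q v}" and p: "p \<in> V - {v \<in> V. \<not> M q v}"
  then obtain R where "R \<subseteq> {..<m}" "congruent_lower_unitriangular M R I"
    unfolding H by blast
  moreover from this(2) have "congruent_lower_unitriangular M (insert q R) (insert p I)"
    using I p by (intro congruent_lower_unitriangular_insert) auto
  ultimately show "insert p I \<in> H"
    unfolding H using I p assms(2) by (intro CollectI conjI exI[of _ "insert q R"]) auto
qed auto

theorem boolean_representable_iff_flat_separation:
  assumes S: "simplicial_complex V H"
  shows "boolean_representable V H \<longleftrightarrow>
    (\<forall>X\<in>H. X \<noteq> {} \<longrightarrow> (\<exists>F\<in>flats V H. \<exists>p\<in>X. p \<notin> F \<and> X - {p} \<subseteq> F))"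
    (is "?L \<longleftrightarrow> ?R")
proof
  assume ?L
  then obtain m M where
    H: "H = {X. X \<subseteq> V \<and> (\<exists>R \<subseteq> {..<m}. congruent_lower_unitriangular M R X)}"
    unfolding boolean_representable_def by blast
  show ?R
  proof (intro ballI impI)
    fix X assume "X \<in> H" "X \<noteq> {}"
    then obtain R where R: "X \<subseteq> V" "R \<subseteq> {..<m}" "congruent_lower_unitriangular M R X"
      unfolding H by blast
    obtain q p where qp: "q \<in> R" "p \<in> X" "M q p" "\<And>x. x \<in> X - {p} \<Longrightarrow> \<not> M q x"
      using congruent_lower_unitriangular_remove[OF R(3) \<open>X \<noteq> {}\<close>] by metis
    have "{v \<in> V. \<not> M q v} \<in> flats V H"
      using flat_row_zero_set[OF H] R(2) qp(1) by (auto simp: flats_def)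
    then show "\<exists>F\<in>flats V H. \<exists>p\<in>X. p \<notin> F \<and> X - {p} \<subseteq> F"
      using qp R(1) by (intro bexI[of _ "{v \<in> V. \<not> M q v}"] bexI[of _ p]) auto
  qed
next
  assume sep: ?R
  have fin: "finite V" and HV: "H \<subseteq> Pow V" and down: "\<And>I J. I \<in> H \<Longrightarrow> J \<subseteq> I \<Longrightarrow> J \<in> H"
    using S by (auto simp: simplicial_complex_def)
  obtain v where "{v} \<in> H" using S by (auto simp: simplicial_complex_def)
  then have "{} \<in> H" by (rule down) simp
  have "flats V H \<subseteq> Pow V" by (auto simp: flats_def flat_def)
  then have "finite (flats V H)" using fin by (simp add: finite_subset)
  \<comment> \<open>Rows are indexed by an initial segment of the naturals, so the flats are
    enumerated; row \<open>i\<close> will be the indicator of the complement of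
    \<open>f i\<close>.\<close>
  then obtain f where "bij_betw f {0..<card (flats V H)} (flats V H)"
    using ex_bij_betw_nat_finite by blast
  then have f: "f ` {..<card (flats V H)} = flats V H"
    by (simp add: bij_betw_def atLeast0LessThan)
  define m where "m = card (flats V H)"
  define M where "M = (\<lambda>i v. v \<notin> f i)"
  have fM: "f ` {..<m} = flats V H" using f by (simp add: m_def)
  have "\<exists>R \<subseteq> {..<m}. congruent_lower_unitriangular M R X" if "X \<in> H" for X
  proof -
    have "finite X" using that HV fin finite_subset by blast
    then show ?thesis using that
    proof (induction X rule: finite_psubset_induct)
      case (psubset X)
      show ?case
      proof (cases "X = {}")
        case True
        then show ?thesis using congruent_lower_unitriangular_empty by blast
      next
        case False
        then obtain F p where F: "F \<in> flats V H" "p \<in> X" "p \<notin> F" "X - {p} \<subseteq> F"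
          using sep psubset.prems by blast
        then obtain q where q: "q < m" "f q = F" using fM by (metis imageE lessThan_iff)
        have "X - {p} \<subset> X" "X - {p} \<in> H" using F(2) down[OF psubset.prems] by auto
        then obtain R where R: "R \<subseteq> {..<m}" "congruent_lower_unitriangular M R (X - {p})"
          using psubset.IH by blast
        have "congruent_lower_unitriangular M (insert q R) (insert p (X - {p}))"
          using R(2) F q by (intro congruent_lower_unitriangular_insert) (auto simp: M_def)
        then show ?thesis
          using R(1) q(1) F(2) by (intro exI[of _ "insert q R"]) (auto simp: insert_absorb)
      qed
    qed
  qed
  \<comment> \<open>The peeled column \<open>p\<close> lies outside the flat \<open>f q\<close>,
    which contains the rest of \<open>X\<close>. That rest is a face by induction, and the flat
    allows \<open>p\<close> to be added back.\<close>
  moreover have "X \<in> H" if "congruent_lower_unitriangular M R X" "R \<subseteq> {..<m}" "X \<subseteq> V" for R X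
    using congruent_lower_unitriangular_finite[OF that(1)] that
  proof (induction X arbitrary: R rule: finite_psubset_induct)
    case (psubset X)
    show ?case
    proof (cases "X = {}")
      case True
      then show ?thesis using \<open>{} \<in> H\<close> by simp
    next
      case False
      obtain q p where qp: "q \<in> R" "p \<in> X" "M q p" "\<And>x. x \<in> X - {p} \<Longrightarrow> \<not> M q x"
        "congruent_lower_unitriangular M (R - {q}) (X - {p})"
        using congruent_lower_unitriangular_remove[OF psubset.prems(1) False] by metis
      have "X - {p} \<in> H"
        using psubset.IH[OF _ qp(5)] qp(2) psubset.prems by blast
      moreover have "flat V H (f q)"
        using fM qp(1) psubset.prems(2) by (auto simp: flats_def)
      moreover have "X - {p} \<subseteq> f q" "p \<in> V - f q"
        using qp psubset.prems(3) by (auto simp: M_def)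
      ultimately have "insert p (X - {p}) \<in> H" unfolding flat_def by blast
      then show ?thesis using qp(2) by (simp add: insert_absorb)
    qed
  qed
  ultimately have "H = {X. X \<subseteq> V \<and> (\<exists>R \<subseteq> {..<m}. congruent_lower_unitriangular M R X)}"
    using HV by blast
  then show ?L unfolding boolean_representable_def by blast
qed

section \<open>Faces and flats of paving complexes\<close>

lemma card_face_le:
  assumes "simplicial_complex V H" "X \<in> H"
  shows "card X \<le> complex_dim H + 1"
proof -
  have "finite H"
    using assms(1) unfolding simplicial_complex_def by (meson finite_Pow_iff finite_subset)
  then have "card X \<le> Max (card ` H)" using assms(2) by simp
  then show ?thesis by (simp add: complex_dim_def)
qed

lemma ex_face_card_eq:
  assumes "simplicial_complex V H"
  obtains X where "X \<in> H" "card X = complex_dim H + 1"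
proof -
  have fin: "finite H"
    using assms unfolding simplicial_complex_def by (meson finite_Pow_iff finite_subset)
  obtain v where v: "{v} \<in> H" using assms by (auto simp: simplicial_complex_def)
  then have "Max (card ` H) \<in> card ` H" using fin by (intro Max_in) auto
  then obtain X where "X \<in> H" "card X = Max (card ` H)" by auto
  \<comment> \<open>The maximum is at least 1, so the subtraction in \<open>complex_dim\<close> is
    undone by adding 1.\<close>
  moreover have "card {v} \<le> Max (card ` H)" using fin v by (intro Max_ge finite_imageI imageI)
  ultimately show thesis using that by (simp add: complex_dim_def)
qed

lemma paving_faces:
  assumes S: "simplicial_complex V H" and P: "paving V H"
  shows "nsets_le V (complex_dim H) \<subseteq> H"
proof
  fix X assume "X \<in> nsets_le V (complex_dim H)"
  then have X: "X \<subseteq> V" "card X \<le> complex_dim H" by (auto simp: nsets_le_def)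
  have fin: "finite V" and down: "\<And>I J. I \<in> H \<Longrightarrow> J \<subseteq> I \<Longrightarrow> J \<in> H"
    using S unfolding simplicial_complex_def by blast+
  obtain Y where Y: "Y \<in> H" "card Y = complex_dim H + 1" using ex_face_card_eq[OF S] .
  \<comment> \<open>The facet \<open>Y\<close> shows that \<open>V\<close> is large enough to
    enlarge \<open>X\<close> to a set of size exactly \<open>complex_dim H\<close>, which is a face
    by paving.\<close>
  have "card Y \<le> card V"
    using S Y(1) by (intro card_mono fin) (auto simp: simplicial_complex_def)
  then obtain Z where "X \<subseteq> Z" "Z \<subseteq> V" "card Z = complex_dim H"
    using exists_subset_between[of X "complex_dim H" V] X Y(2) fin by auto
  then have "Z \<in> H" using P fin by (auto simp: paving_def nsets_def finite_subset)
  then show "X \<in> H" using down \<open>X \<subseteq> Z\<close> by blast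
qed

text \<open>Adding one point to a subset of \<open>F\<close> gives at most
  \<open>complex_dim H\<close> points, hence a face.\<close>

lemma paving_flat_small:
  assumes "simplicial_complex V H" "paving V H" "F \<subseteq> V" "card F < complex_dim H"
  shows "flat V H F"
  unfolding flat_def
proof (intro conjI ballI)
  fix I p assume I: "I \<in> H \<inter> Pow F" and p: "p \<in> V - F"
  have "finite F" using assms(1,3) finite_subset by (auto simp: simplicial_complex_def)
  then have "finite I" "card I \<le> card F" using I by (auto intro: finite_subset card_mono)
  then have "insert p I \<in> nsets_le V (complex_dim H)"
    using I p assms(3,4) by (auto simp: nsets_le_def card_insert_if)
  then show "insert p I \<in> H" using paving_faces[OF assms(1,2)] by blast
qed (rule assms(3))

text \<open>A point outside \<open>F\<close> extends \<open>I\<close> to a larger face, whose size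
  is bounded by the dimension.\<close>

lemma proper_flat_face_card_le:
  assumes S: "simplicial_complex V H" and F: "flat V H F" "F \<noteq> V" and I: "I \<in> H" "I \<subseteq> F"
  shows "card I \<le> complex_dim H"
proof -
  obtain p where p: "p \<in> V - F" using F by (auto simp: flat_def)
  then have "insert p I \<in> H" using F I by (auto simp: flat_def)
  then have "card (insert p I) \<le> complex_dim H + 1" by (rule card_face_le[OF S])
  moreover have "finite I" using S I(1) finite_subset by (auto simp: simplicial_complex_def)
  moreover have "p \<notin> I" using p I(2) by auto
  ultimately show ?thesis by simp
qed

text \<open>A set of size \<open>complex_dim H + 1\<close> in this family has just one point outside
  \<open>F\<close>; its trace on \<open>F\<close> is a face by paving, and the flat allows that
  point to be added.\<close>

lemma B_complex_subset_if_flat: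
  assumes S: "simplicial_complex V H" and P: "paving V H" and F: "flat V H F"
  shows "B_complex (complex_dim H) V F \<subseteq> H"
proof
  fix X assume X: "X \<in> B_complex (complex_dim H) V F"
  show "X \<in> H"
  proof (cases "X \<in> nsets_le V (complex_dim H)")
    case True
    then show ?thesis using paving_faces[OF S P] by blast
  next
    case False
    then have X': "X \<subseteq> V" "finite X" "card X = complex_dim H + 1" "card (X \<inter> F) = complex_dim H"
      using X by (auto simp: B_complex_def nsets_def)
    have "X \<inter> F \<in> nsets_le V (complex_dim H)" using X' by (auto simp: nsets_le_def)
    then have face: "X \<inter> F \<in> H" using paving_faces[OF S P] by blast
    have "card (X - F) = 1" using X' card_Diff_subset_Int[of X F] by simp
    then obtain p where p: "X - F = {p}" by (auto simp: card_1_singleton_iff)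
    then have "X = insert p (X \<inter> F)" "p \<in> V - F" using X'(1) by auto
    then show ?thesis using F face unfolding flat_def by (metis IntI Int_lower2 PowI)
  qed
qed

text \<open>Otherwise a common subset of size \<open>complex_dim H\<close>, extended by a point of
  one flat outside the other, would be a face too large for the proper flat containing it.\<close>

lemma card_Int_proper_flats_less:
  assumes S: "simplicial_complex V H" and P: "paving V H"
    and F: "flat V H F" "F \<noteq> V" and G: "flat V H G" "G \<noteq> V" and "F \<noteq> G"
  shows "card (F \<inter> G) < complex_dim H"
proof -
  \<comment> \<open>Distinct flats fail at least one of the two inclusions, so it suffices by
    symmetry to treat this case.\<close>
  have less: "card (F \<inter> G) < complex_dim H"
    if F: "flat V H F" "F \<noteq> V" and G: "flat V H G" "G \<noteq> V" and ne: "\<not> G \<subseteq> F" for F G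
  proof (rule ccontr)
    assume "\<not> card (F \<inter> G) < complex_dim H"
    then obtain I where I: "I \<subseteq> F \<inter> G" "finite I" "card I = complex_dim H"
      by (meson not_less obtain_subset_with_card_n)
    obtain p where p: "p \<in> G" "p \<notin> F" using ne by blast
    have "I \<in> nsets_le V (complex_dim H)"
      using I F(1) by (auto simp: nsets_le_def flat_def)
    then have "I \<in> H" using paving_faces[OF S P] by blast
    then have "insert p I \<in> H" using F(1) G(1) I(1) p by (auto simp: flat_def)
    then have "card (insert p I) \<le> complex_dim H"
      using proper_flat_face_card_le[OF S G, of "insert p I"] I(1) p(1) by blast
    moreover have "p \<notin> I" using I(1) p(2) by blast
    ultimately show False using I by simp
  qed
  show ?thesis
    using less[OF F G] less[OF G F] \<open>F \<noteq> G\<close> by (cases "G \<subseteq> F") (auto simp: Int_commute)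
qed

text \<open>No face \<open>I\<close> inside \<open>L\<close> has \<open>d + 1\<close> points: it
  would come from a member \<open>L'\<close> meeting it in \<open>d\<close> points, so
  \<open>L'\<close> differs from \<open>L\<close> yet shares \<open>d\<close> points with it. Adding
  an outside point to a face of size at most \<open>d\<close> inside \<open>L\<close> stays in
  \<open>B_complex d V L\<close>.\<close>

lemma flat_if_small_intersections:
  assumes "finite V" and H: "H = (\<Union>L\<in>\<L>. B_complex d V L)" and L: "L \<in> \<L>" "L \<subseteq> V"
    and small: "\<And>L'. L' \<in> \<L> \<Longrightarrow> L' \<noteq> L \<Longrightarrow> card (L \<inter> L') < d"
  shows "flat V H L"
  unfolding flat_def
proof (intro conjI ballI)
  fix I p assume I: "I \<in> H \<inter> Pow L" and p: "p \<in> V - L"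
  have finL: "finite L" using assms(1) L(2) by (rule rev_finite_subset)
  have finI: "finite I" using I finL by (auto intro: finite_subset)
  obtain L' where L': "L' \<in> \<L>" "I \<in> B_complex d V L'" using I H by blast
  have le: "card I \<le> d"
  proof (rule ccontr)
    assume "\<not> card I \<le> d"
    then have card: "card I = d + 1" "card (I \<inter> L') = d"
      using L'(2) by (auto simp: B_complex_def nsets_le_def nsets_def)
    have "L' \<noteq> L" using card I by (auto simp: Int_absorb2)
    moreover have "card (I \<inter> L') \<le> card (L \<inter> L')"
      using I finL by (intro card_mono) auto
    ultimately show False using small[OF L'(1)] card(2) by simp
  qed
  have "insert p I \<in> B_complex d V L"
  proof (cases "card I = d")
    case True
    moreover have "p \<notin> I" "insert p I \<inter> L = I" using I p by auto
    ultimately show ?thesis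
      using finI I p L(2) by (auto simp: B_complex_def nsets_def)
  next
    case False
    then show ?thesis
      using le finI I p L(2) by (auto simp: B_complex_def nsets_le_def card_insert_if)
  qed
  then show "insert p I \<in> H" using H L(1) by blast
qed (rule L(2))

section \<open>The equivalence of the three descriptions\<close>

theorem theorem5p8:
  fixes V :: "'a set" and H :: "'a set set" and d :: nat
  assumes "d \<ge> 2"
    and "simplicial_complex V H"
    and "paving V H"
    and "complex_dim H = d"
  shows "(boolean_representable V H \<longleftrightarrow>
            H = (\<Union>L \<in> flats V H - (nsets_le V (d - 1) \<union> {V}). B_complex d V L)) \<and>
         (H = (\<Union>L \<in> flats V H - (nsets_le V (d - 1) \<union> {V}). B_complex d V L) \<longleftrightarrow>
            (\<exists>\<L>. \<L> \<noteq> {} \<and> \<L> \<subseteq> nsets_ge V d - {V} \<and>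
               (\<forall>L\<in>\<L>. \<forall>L'\<in>\<L>. L \<noteq> L' \<longrightarrow> card (L \<inter> L') \<le> d - 1) \<and>
               H = (\<Union>L\<in>\<L>. B_complex d V L)))"
proof -
  note S = assms(2) and P = assms(3) and dim = assms(4)
  have fin: "finite V" and HV: "H \<subseteq> Pow V"
    using S by (simp_all add: simplicial_complex_def)
  let ?F = "flats V H - (nsets_le V (d - 1) \<union> {V})"
  have memF: "L \<in> ?F \<longleftrightarrow> flat V H L \<and> L \<noteq> V \<and> d \<le> card L" for L
    using fin \<open>d \<ge> 2\<close> finite_subset[OF _ fin, of L]
    by (auto simp: flats_def flat_def nsets_le_def)
  have UF: "(\<Union>L\<in>?F. B_complex d V L) \<subseteq> H"
    using B_complex_subset_if_flat[OF S P] memF unfolding dim by blast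
  \<comment> \<open>This facet serves to show that the index set \<open>?F\<close> is
    nonempty.\<close>
  obtain X0 where X0: "X0 \<in> H" "card X0 = d + 1"
    using ex_face_card_eq[OF S] unfolding dim by blast
  have i_ii: "H = (\<Union>L\<in>?F. B_complex d V L)" if br: "boolean_representable V H"
  proof -
    have cover: "\<exists>L\<in>?F. X \<in> B_complex d V L" if X: "X \<in> H" "card X = d + 1" for X
    proof -
      have XV: "X \<subseteq> V" "finite X" using X(1) HV fin finite_subset by blast+
      have "X \<noteq> {}" using X(2) by auto
      then obtain L p where L: "flat V H L" "p \<in> X" "p \<notin> L" "X - {p} \<subseteq> L"
        using br X(1) unfolding boolean_representable_iff_flat_separation[OF S] flats_def by blast
      have card: "card (X \<inter> L) = d"
      proof -
        have "X \<inter> L = X - {p}" using L by auto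
        then show ?thesis using X(2) L(2) XV(2) by simp
      qed
      have "finite L" using L(1) fin finite_subset by (auto simp: flat_def)
      then have "d \<le> card L" using card card_mono[of L "X \<inter> L"] by simp
      \<comment> \<open>The separated vertex \<open>p\<close> lies in \<open>V\<close> but not in
        \<open>L\<close>, so \<open>L\<close> is proper.\<close>
      then have "L \<in> ?F" unfolding memF using L(1,2,3) XV(1) by blast
      moreover have "X \<in> B_complex d V L"
        using card X(2) XV by (auto simp: B_complex_def nsets_def)
      ultimately show ?thesis by blast
    qed
    have "X \<in> (\<Union>L\<in>?F. B_complex d V L)" if X: "X \<in> H" for X
    proof (cases "card X = d + 1")
      case True
      then show ?thesis using cover X by blast
    next
      case False
      then have "X \<in> nsets_le V d"
        using card_face_le[OF S X] X HV finite_subset[OF _ fin, of X] unfolding dim nsets_le_def by auto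
      \<comment> \<open>Every \<open>B_complex d V L\<close> contains all sets of size at most
        \<open>d\<close>, so any member of \<open>?F\<close> will do.\<close>
      then show ?thesis using cover[OF X0] by (auto simp: B_complex_def)
    qed
    then show ?thesis using UF by blast
  qed
  have ii_i: "boolean_representable V H" if ii: "H = (\<Union>L\<in>?F. B_complex d V L)"
    unfolding boolean_representable_iff_flat_separation[OF S]
  proof (intro ballI impI)
    fix X assume X: "X \<in> H" "X \<noteq> {}"
    have XV: "X \<subseteq> V" "finite X" using X(1) HV fin finite_subset by blast+
    show "\<exists>F\<in>flats V H. \<exists>p\<in>X. p \<notin> F \<and> X - {p} \<subseteq> F"
    proof (cases "card X \<le> d")
      case True
      obtain p where p: "p \<in> X" using X(2) by blast
      \<comment> \<open>The separating flat is \<open>X - {p}\<close> itself, having fewer than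
        \<open>d\<close> points.\<close>
      have "card (X - {p}) < card X" using p XV(2) by (rule card_Diff1_less[rotated])
      then have "flat V H (X - {p})"
        using True XV(1) by (intro paving_flat_small[OF S P]) (auto simp: dim)
      then show ?thesis using p by (auto simp: flats_def)
    next
      case False
      obtain L where L: "L \<in> ?F" "X \<in> B_complex d V L" using X(1) ii by blast
      then have "card X = d + 1" "card (X \<inter> L) = d"
        using False by (auto simp: B_complex_def nsets_le_def nsets_def)
      then have "card (X - L) = 1" using XV(2) card_Diff_subset_Int[of X L] by simp
      then obtain p where "X - L = {p}" by (auto simp: card_1_singleton_iff)
      then show ?thesis using L(1) by blast
    qed
  qed
  let ?iii = "\<lambda>\<L>. \<L> \<noteq> {} \<and> \<L> \<subseteq> nsets_ge V d - {V} \<and>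
    (\<forall>L\<in>\<L>. \<forall>L'\<in>\<L>. L \<noteq> L' \<longrightarrow> card (L \<inter> L') \<le> d - 1) \<and> H = (\<Union>L\<in>\<L>. B_complex d V L)"
  have ii_iii: "?iii ?F" if ii: "H = (\<Union>L\<in>?F. B_complex d V L)"
  proof (intro conjI ballI impI)
    \<comment> \<open>An empty union would leave no room for the face \<open>X0\<close>.\<close>
    show "?F \<noteq> {}" using ii X0(1) by blast
    show "?F \<subseteq> nsets_ge V d - {V}"
    proof
      fix L assume "L \<in> ?F"
      then have "L \<subseteq> V" "L \<noteq> V" "d \<le> card L" unfolding memF by (auto simp: flat_def)
      then show "L \<in> nsets_ge V d - {V}"
        using finite_subset[OF _ fin] by (simp add: nsets_ge_def)
    qed
    show "card (L \<inter> L') \<le> d - 1" if "L \<in> ?F" "L' \<in> ?F" "L \<noteq> L'" for L L'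
      using card_Int_proper_flats_less[OF S P, of L L'] that unfolding memF dim by auto
    show "H = (\<Union>L\<in>?F. B_complex d V L)" by (rule ii)
  qed
  have iii_ii: "H = (\<Union>L\<in>?F. B_complex d V L)" if iii: "?iii \<L>" for \<L>
  proof -
    have H: "H = (\<Union>L\<in>\<L>. B_complex d V L)" using iii by blast
    \<comment> \<open>Every member of the given family is one of the flats in \<open>?F\<close>.
      Enlarging the family to \<open>?F\<close> adds no new faces, by \<open>UF\<close>.\<close>
    have "L \<in> ?F" if "L \<in> \<L>" for L
    proof -
      have L: "L \<subseteq> V" "L \<noteq> V" "d \<le> card L" using that iii by (auto simp: nsets_ge_def)
      have "card (L \<inter> L') < d" if "L' \<in> \<L>" "L' \<noteq> L" for L'
      proof -
        have "card (L \<inter> L') \<le> d - 1" using that iii \<open>L \<in> \<L>\<close> by blast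
        then show ?thesis using \<open>d \<ge> 2\<close> by simp
      qed
      then have "flat V H L" by (intro flat_if_small_intersections[OF fin H that L(1)])
      then show ?thesis unfolding memF using L by blast
    qed
    then have "H \<subseteq> (\<Union>L\<in>?F. B_complex d V L)" unfolding H[symmetric] by (subst H) blast
    then show ?thesis using UF by blast
  qed
  show ?thesis
  proof (intro conjI iffI)
    assume "boolean_representable V H"
    then show "H = (\<Union>L\<in>?F. B_complex d V L)" by (rule i_ii)
  next
    assume "H = (\<Union>L\<in>?F. B_complex d V L)"
    then show "boolean_representable V H" by (rule ii_i)
  next
    assume "H = (\<Union>L\<in>?F. B_complex d V L)"
    then have "?iii ?F" by (rule ii_iii)
    then show "\<exists>\<L>. ?iii \<L>" by (rule exI)
  next
    assume "\<exists>\<L>. ?iii \<L>"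
    then obtain \<L> where "?iii \<L>" ..
    then show "H = (\<Union>L\<in>?F. B_complex d V L)" by (rule iii_ii)
  qed
qed

end
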